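(* Let $(c_n)_{n \in \mathbb{N}}$ be the unique real sequence such that $(X^n - c_n) \in \mathscr{E}_2$ for all $n \in \mathbb{N}$. Then for every natural number $n$ we have $$c_n = E_n(0) = \frac{G_{n + 1}}{n + 1} ,$$ where $E_n(X)$ is the $n$-th Euler polynomial and $G_{n+1}$ is the $(n+1)$-th Genocchi number.
   Context: Here $\mathbb{N} = \{0, 1, 2, \dots\}$. $\mathscr{E}_2$ denotes the set (an $\mathbb{R}$-linear subspace of $\mathbb{R}[X]$) of all polynomials $P \in \mathbb{R}[X]$ for which the sum $P(n) + P(n-2) + P(n-4) + \cdots := \sum_{0 \leq k \leq n/2} P(n - 2k)$ (the sum over integers $k \ge 0$ with $n - 2k \geq 0$) is polynomial in $n \in \mathbb{N}$, i.e. there exists $S \in \mathbb{R}[X]$ such that this sum equals $S(n)$ for all $n \in \mathbb{N}$. It is known that there is exactly one real sequence $(c_n)_{n\in\mathbb{N}}$ with $(X^n - c_n) \in \mathscr{E}_2$ for all $n \in \mathbb{N}$. The Euler polynomials $E_n(X)$ and the Genocchi numbers $G_n$ ($n \in \mathbb{N}$) are defined by the exponential generating functions $\frac{2 e^{Xt}}{e^t + 1} = \sum_{n=0}^{+\infty} E_n(X) \frac{t^n}{n!}$ and $\frac{2t}{e^t + 1} = \sum_{n=0}^{+\infty} G_n \frac{t^n}{n!}$. *)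

theory Defs
  imports Complex_Main "HOL-Computational_Algebra.Computational_Algebra"
begin

definition E2 :: "real poly set" where
  "E2 = {P. \<exists>S :: real poly. \<forall>n::nat.
          (\<Sum>k = 0..n div 2. poly P (real (n - 2 * k))) = poly S (real n)}"

text \<open>Generating functions are formal power series in \<open>t\<close>; \<open>fps_exp a\<close> is \<open>exp (a t)\<close>.
  The series for the Euler polynomials lives in \<open>\<real>[X][[t]]\<close>, where there is no division operation;
  hence the real series \<open>2 / (exp t + 1)\<close> is formed first and its coefficients are embedded
  as constant polynomials before multiplying by \<open>exp (X t)\<close>.\<close>

definition const_poly_fps :: "real fps \<Rightarrow> real poly fps" where
  "const_poly_fps f = Abs_fps (\<lambda>n. [:fps_nth f n:])"

definition exp_Xt :: "real poly fps" where
  "exp_Xt = Abs_fps (\<lambda>n. monom (1 / fact n) n)"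

definition euler_poly :: "nat \<Rightarrow> real poly" where
  "euler_poly n =
     smult (fact n) (fps_nth (const_poly_fps (2 / (fps_exp 1 + 1)) * exp_Xt) n)"

definition genocchi :: "nat \<Rightarrow> real" where
  "genocchi n = fact n * fps_nth (2 * fps_X / (fps_exp 1 + 1)) n"

lemma euler_poly_generating_function:
  "Abs_fps (\<lambda>n. poly (euler_poly n) x / fact n) = 2 * fps_exp x / (fps_exp 1 + 1)"
proof -
  have nz: "fps_nth (fps_exp 1 + 1 :: real fps) 0 \<noteq> 0" by simp
  have "Abs_fps (\<lambda>n. poly (euler_poly n) x / fact n) = (2 / (fps_exp 1 + 1)) * fps_exp x"
    by (rule fps_ext)
      (simp add: euler_poly_def const_poly_fps_def exp_Xt_def fps_mult_nth poly_sum poly_monom)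
  also have "\<dots> = 2 * fps_exp x / (fps_exp 1 + 1)"
    using nz by (simp add: fps_divide_unit mult_ac)
  finally show ?thesis .
qed

text \<open>Existence and uniqueness of the sequence \<open>c\<close> with \<open>X^n - c n \<in> E2\<close> for all \<open>n\<close>.\<close>

lemma X_power_minus_const_in_E2_iff:
  "monom 1 n - [:c:] \<in> E2 \<longleftrightarrow> (\<exists>S. \<forall>m.
     (\<Sum>k = 0..m div 2. real (m - 2 * k) ^ n) - c * real (m div 2 + 1) = poly S (real m))"
  by (simp add: E2_def poly_monom sum_subtractf mult.commute)

lemma half_not_poly: "\<not> (\<exists>S. \<forall>m. real (m div 2 + 1) = poly S (real m))"
proof
  assume "\<exists>S. \<forall>m. real (m div 2 + 1) = poly S (real m)"
  then obtain S where S: "\<And>m. poly S (real m) = real (m div 2 + 1)" by metis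
  define T where "T = smult 2 S - [:1, 1:]"
  have "poly T (real (2 * i + 1)) = 0" for i
    unfolding T_def poly_diff poly_smult S by simp
  hence "range (\<lambda>i::nat. real (2 * i + 1)) \<subseteq> {x. poly T x = 0}" by auto
  moreover have "infinite (range (\<lambda>i::nat. real (2 * i + 1)))"
    by (rule range_inj_infinite) (auto simp: inj_def)
  ultimately have "T = 0" using poly_roots_finite finite_subset by blast
  moreover have "poly T (real 0) = 1"
    unfolding T_def poly_diff poly_smult S by simp
  ultimately show False by simp
qed

lemma const_in_E2_exists: "\<exists>c. monom 1 n - [:c:] \<in> E2"
proof (induction n rule: less_induct)
  case (less n)
  define F where "F = (\<lambda>j m. \<Sum>k = 0..m div 2. real (m - 2 * k) ^ j)"
  have "\<forall>j<n. \<exists>c S. \<forall>m. F j m - c * real (m div 2 + 1) = poly S (real m)"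
    using less unfolding X_power_minus_const_in_E2_iff F_def by blast
  then obtain c S where cS: "\<And>j m. j < n \<Longrightarrow> F j m = c j * real (m div 2 + 1) + poly (S j) (real m)"
    by (metis add.commute diff_add_cancel)
  define b where "b = (\<lambda>j. - (real (Suc n choose j) * (-2) ^ (Suc n - j)))"
  define r where "r = (\<lambda>m::nat. (if even m then (-2) ^ Suc n else (-1) ^ Suc n :: real))"
  have b_diff: "x ^ Suc n - (x - 2) ^ Suc n = (\<Sum>j\<le>n. b j * x ^ j)" for x :: real
  proof -
    have "(x + (-2)) ^ Suc n = (\<Sum>j\<le>Suc n. real (Suc n choose j) * x ^ j * (-2) ^ (Suc n - j))"
      by (rule binomial_ring)
    also have "\<dots> = x ^ Suc n - (\<Sum>j\<le>n. b j * x ^ j)"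
      by (simp add: b_def sum_negf mult_ac del: binomial_Suc_Suc)
    finally show ?thesis by simp
  qed
  have tele: "(\<Sum>j\<le>n. b j * F j m) = real m ^ Suc n - r m" for m
  proof -
    have "(\<Sum>j\<le>n. b j * F j m) = (\<Sum>k = 0..m div 2. \<Sum>j\<le>n. b j * real (m - 2 * k) ^ j)"
      unfolding F_def sum_distrib_left by (rule sum.swap)
    also have "\<dots> = (\<Sum>k = 0..m div 2. (real m - 2 * real k) ^ Suc n - (real m - 2 * real (Suc k)) ^ Suc n)"
    proof (rule sum.cong)
      fix k assume "k \<in> {0..m div 2}"
      hence e: "real (m - 2 * k) = real m - 2 * real k"
        by (subst of_nat_diff) auto
      show "(\<Sum>j\<le>n. b j * real (m - 2 * k) ^ j)
          = (real m - 2 * real k) ^ Suc n - (real m - 2 * real (Suc k)) ^ Suc n"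
        unfolding b_diff[symmetric] e by (simp add: algebra_simps)
    qed simp
    also have "\<dots> = real m ^ Suc n - (real m - 2 * real (Suc (m div 2))) ^ Suc n"
      using sum_Suc_diff[of 0 "m div 2" "\<lambda>k. - ((real m - 2 * real k) ^ Suc n)"] by simp
    also have "real m - 2 * real (Suc (m div 2)) = (if even m then -2 else -1)"
      by (auto elim!: evenE oddE)
    finally show ?thesis by (simp add: r_def)
  qed
  have bn: "b n \<noteq> 0" by (simp add: b_def)
  define \<alpha> :: real where "\<alpha> = (-1) ^ Suc n"
  define \<beta> :: real where "\<beta> = (-2) ^ Suc n - (-1) ^ Suc n"
  have r: "r m = \<alpha> + \<beta> * (2 * real (m div 2 + 1) - real m - 1)" for m
    by (auto simp: r_def \<alpha>_def \<beta>_def elim!: evenE oddE)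
  define C where "C = (- 2 * \<beta> - (\<Sum>j<n. b j * c j)) / b n"
  define T where "T = smult (1 / b n)
    (monom 1 (Suc n) - [:\<alpha>:] + smult \<beta> [:1, 1:] - (\<Sum>j<n. smult (b j) (S j)))"
  have "F n m - C * real (m div 2 + 1) = poly T (real m)" for m
  proof -
    define h where "h = real (m div 2 + 1)"
    have "(\<Sum>j<n. b j * F j m) = (\<Sum>j<n. b j * c j) * h + (\<Sum>j<n. b j * poly (S j) (real m))"
      by (simp add: cS[of _ m, folded h_def] sum_distrib_right sum.distrib[symmetric] distrib_left
          mult.assoc)
    moreover have "(\<Sum>j\<le>n. b j * F j m) = (\<Sum>j<n. b j * F j m) + b n * F n m"
      by (simp add: lessThan_Suc_atMost[symmetric])
    ultimately have 1: "b n * F n m = real m ^ Suc n - (\<alpha> + \<beta> * (2 * h - real m - 1))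
        - (\<Sum>j<n. b j * c j) * h - (\<Sum>j<n. b j * poly (S j) (real m))"
      using tele[of m] unfolding r h_def by linarith
    have 2: "b n * poly T (real m) = real m ^ Suc n - \<alpha> + \<beta> * (1 + real m)
        - (\<Sum>j<n. b j * poly (S j) (real m))"
      using bn by (simp add: T_def poly_monom poly_sum distrib_left mult.commute)
    have 3: "b n * (C * h) = (- 2 * \<beta> - (\<Sum>j<n. b j * c j)) * h"
      using bn by (simp add: C_def)
    have "b n * (F n m - C * h) = b n * poly T (real m)"
      unfolding right_diff_distrib 1 2 3 by (simp add: algebra_simps)
    thus ?thesis using bn unfolding h_def by simp
  qed
  thus ?case unfolding X_power_minus_const_in_E2_iff F_def by blast
qed

lemma E2_const_sequence_unique_exists:
  "\<exists>!c :: nat \<Rightarrow> real. \<forall>n. monom 1 n - [:c n:] \<in> E2"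
proof (rule ex_ex1I)
  show "\<exists>c. \<forall>n. monom 1 n - [:c n:] \<in> E2"
    using const_in_E2_exists by (intro choice allI)
next
  fix c d :: "nat \<Rightarrow> real"
  assume c: "\<forall>n. monom 1 n - [:c n:] \<in> E2" and d: "\<forall>n. monom 1 n - [:d n:] \<in> E2"
  show "c = d"
  proof (rule ext, rule ccontr)
    fix n assume ne: "c n \<noteq> d n"
    define f where "f = (\<lambda>m. \<Sum>k = 0..m div 2. real (m - 2 * k) ^ n)"
    obtain S where S: "\<And>m. f m - c n * real (m div 2 + 1) = poly S (real m)"
      using c unfolding X_power_minus_const_in_E2_iff f_def by metis
    obtain T where T: "\<And>m. f m - d n * real (m div 2 + 1) = poly T (real m)"
      using d unfolding X_power_minus_const_in_E2_iff f_def by metis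
    have "real (m div 2 + 1) = poly (smult (1 / (d n - c n)) (S - T)) (real m)" for m
      unfolding poly_smult poly_diff S[symmetric] T[symmetric]
      using ne by (simp add: field_simps)
    thus False using half_not_poly by blast
  qed
qed

end

theory Submission
  imports Defs
begin

text \<open>If \<open>X^n - c\<close> has the summation polynomial \<open>S\<close>, then \<open>S(x) - S(x - 2) = x^n - c\<close> with
  \<open>S(-1) = S(-2) = 0\<close>. Thus \<open>2 (S(x) - S(x - 1)) + c\<close> solves the equation
  \<open>f(x) + f(x - 1) = 2 x^n\<close>, whose only polynomial solution is \<open>E\<^sub>n(x + 1)\<close>; evaluating
  at \<open>x = -1\<close> gives \<open>c = E\<^sub>n(0)\<close>.\<close>

lemma poly_eqI_on_nat:
  fixes p q :: "real poly"
  assumes "\<And>m::nat. poly p (real m) = poly q (real m)"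
  shows "p = q"
proof -
  have "range real \<subseteq> {x. poly (p - q) x = 0}" using assms by auto
  moreover have "infinite (range real)"
    by (rule range_inj_infinite) (auto simp: inj_def)
  ultimately have "p - q = 0" using poly_roots_finite finite_subset by blast
  thus ?thesis by simp
qed

text \<open>Shifting the argument preserves the leading coefficient, but here the shift by -1
  negates \<open>p\<close>; a real number equal to its own negative is 0.\<close>

lemma poly_alternating_eq_0:
  fixes p :: "real poly"
  assumes "\<And>x. poly p (x - 1) + poly p x = 0"
  shows "p = 0"
proof -
  have "p \<circ>\<^sub>p [:-1, 1:] = - p"
    by (rule poly_eq_poly_eq_iff[THEN iffD1], rule ext)
      (use assms in \<open>simp add: poly_pcompose eq_neg_iff_add_eq_0\<close>)
  moreover have "lead_coeff (p \<circ>\<^sub>p [:-1, 1:]) = lead_coeff p"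
    by (subst lead_coeff_comp) auto
  ultimately have "lead_coeff p = - lead_coeff p" by (metis lead_coeff_minus)
  thus ?thesis by simp
qed

text \<open>Adding the generating functions at \<open>x + 1\<close> and \<open>x\<close> produces
  the factor exp t + 1, which cancels the denominator and leaves 2 exp(x t).\<close>

lemma euler_poly_add_1: "poly (euler_poly n) (x + 1) + poly (euler_poly n) x = 2 * x ^ n"
proof -
  define d :: "real fps" where "d = fps_exp 1 + 1"
  have nz: "fps_nth d 0 \<noteq> 0" by (simp add: d_def)
  hence d0: "d \<noteq> 0" by auto
  have "Abs_fps (\<lambda>n. poly (euler_poly n) (x + 1) / fact n)
      + Abs_fps (\<lambda>n. poly (euler_poly n) x / fact n)
      = 2 * fps_exp (x + 1) / d + 2 * fps_exp x / d"
    unfolding euler_poly_generating_function d_def ..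
  also have "\<dots> = 2 * fps_exp x * d / d"
    by (simp add: fps_divide_unit[OF nz] d_def[symmetric] fps_exp_add_mult)
      (simp add: d_def algebra_simps)
  also have "\<dots> = 2 * fps_exp x"
    using d0 by simp
  finally have "fps_nth (Abs_fps (\<lambda>n. poly (euler_poly n) (x + 1) / fact n)
      + Abs_fps (\<lambda>n. poly (euler_poly n) x / fact n)) n = fps_nth (2 * fps_exp x) n"
    by simp
  thus ?thesis by (simp add: numeral_fps_const field_simps)
qed

lemma euler_poly_0_eq: "poly (euler_poly n) 0 = fact n * fps_nth (2 / (fps_exp 1 + 1)) n"
proof -
  have "fps_nth (Abs_fps (\<lambda>n. poly (euler_poly n) 0 / fact n)) n
      = fps_nth (2 / (fps_exp 1 + 1)) n"
    unfolding euler_poly_generating_function by simp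
  thus ?thesis by (simp add: field_simps)
qed

text \<open>The extra factor t shifts coefficients by one, and (n + 1)! = (n + 1) n!.\<close>

lemma genocchi_Suc: "genocchi (Suc n) = real (Suc n) * poly (euler_poly n) 0"
proof -
  have "2 * fps_X / (fps_exp 1 + 1) = fps_X * (2 / (fps_exp 1 + 1) :: real fps)"
    by (simp add: fps_divide_unit mult_ac)
  thus ?thesis by (simp add: genocchi_def euler_poly_0_eq algebra_simps)
qed

lemma E2_summation_poly:
  assumes "P \<in> E2"
  obtains S where "\<And>x. poly S x - poly S (x - 2) = poly P x" "poly S (-1) = 0" "poly S (-2) = 0"
proof -
  obtain S where S: "\<And>m. (\<Sum>k = 0..m div 2. poly P (real (m - 2 * k))) = poly S (real m)"
    using assms unfolding E2_def by auto
  have step: "poly S (real m + 2) = poly P (real m + 2) + poly S (real m)" for m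
  proof -
    have "poly S (real (m + 2)) = (\<Sum>k = 0..Suc (m div 2). poly P (real (m + 2 - 2 * k)))"
      unfolding S[symmetric] by simp
    \<comment> \<open>The term k = 0 is split off; replacing k by k + 1 in the others gives the sum
      for \<open>m\<close>.\<close>
    also have "\<dots> = poly P (real (m + 2)) + (\<Sum>k = 0..m div 2. poly P (real (m - 2 * k)))"
      by (subst sum.atLeast0_atMost_Suc_shift) simp
    finally show ?thesis unfolding S by (simp add: add.commute)
  qed
  \<comment> \<open>Agreement at all naturals makes this an identity of polynomials, so it may be
    used at negative arguments.\<close>
  have comp: "S \<circ>\<^sub>p [:2, 1:] = P \<circ>\<^sub>p [:2, 1:] + S"
    by (rule poly_eqI_on_nat) (use step in \<open>simp add: poly_pcompose add.commute\<close>)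
  have diff: "poly S x - poly S (x - 2) = poly P x" for x
  proof -
    have "poly (S \<circ>\<^sub>p [:2, 1:] - S) (x - 2) = poly (P \<circ>\<^sub>p [:2, 1:]) (x - 2)"
      unfolding comp by simp
    thus ?thesis by (simp add: poly_pcompose)
  qed
  \<comment> \<open>For n = 0 and n = 1 the sum has the single term P(n), so S(n) = P(n) and the
    difference equation forces S(n - 2) = 0.\<close>
  have "poly S (-2) = 0" using S[of 0] diff[of 0] by simp
  moreover have "poly S (-1) = 0" using S[of 1] diff[of 1] by simp
  ultimately show thesis using that diff by blast
qed

lemma E2_const_eq_euler_poly_0:
  assumes "monom 1 n - [:c:] \<in> E2"
  shows "c = poly (euler_poly n) 0"
proof -
  obtain S where S: "\<And>x. poly S x - poly S (x - 2) = x ^ n - c"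
    and S1: "poly S (-1) = 0" and S2: "poly S (-2) = 0"
    using E2_summation_poly[OF assms] by (auto simp: poly_monom)
  define Q where "Q = smult 2 (S - S \<circ>\<^sub>p [:-1, 1:]) + [:c:] - euler_poly n \<circ>\<^sub>p [:1, 1:]"
  have Q: "poly Q x = 2 * (poly S x - poly S (x - 1)) + c - poly (euler_poly n) (x + 1)" for x
    by (simp add: Q_def poly_pcompose add.commute)
  \<comment> \<open>The differences of \<open>S\<close> telescope to S(x) - S(x - 2), so the sum is
    2 (x^n - c) + 2 c - 2 x^n.\<close>
  have "poly Q (x - 1) + poly Q x = 0" for x
    unfolding Q using S[of x] euler_poly_add_1[of n x] by simp
  hence "Q = 0" by (rule poly_alternating_eq_0)
  with Q[of "-1"] S1 S2 show ?thesis by simp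
qed

theorem theorem2p5:
  fixes c :: "nat \<Rightarrow> real"
  assumes "\<forall>n. monom 1 n - [:c n:] \<in> E2"
  shows "\<forall>n. c n = poly (euler_poly n) 0
           \<and> poly (euler_poly n) 0 = genocchi (n + 1) / real (n + 1)"
  using assms E2_const_eq_euler_poly_0 by (auto simp: genocchi_Suc simp del: of_nat_Suc)

end
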